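(* Let $a\in L^1(I)$ and suppose that the Neumann problem on $J$ with potential $\tilde a$ is nonresonant and $G_N[\tilde a,2T]\ge 0$ on $J\times J$. Let $\sigma_1,\sigma_2\in L^1(I)$, let $u_N$ be the unique solution of the Neumann problem $u''+a(t)u=\sigma_1(t)$ a.e. on $I$, $u'(0)=u'(T)=0$, and let $u_{M_1}$ be the unique solution of the mixed problem $u''+a(t)u=\sigma_2(t)$ a.e. on $I$, $u'(0)=u(T)=0$. If $|\sigma_2(t)|\le\sigma_1(t)$ for a.e. $t\in I$, then $|u_{M_1}(t)|\le u_N(t)$ for all $t\in I$.
   Context: Fix $T>0$ and put $I=[0,T]$, $J=[0,2T]$. Solutions are functions $u\in C^1$ with $u'$ absolutely continuous on the interval in question. $\tilde a$ is the even extension of $a$ to $J$: $\tilde a(t)=a(t)$ on $[0,T]$, $\tilde a(t)=a(2T-t)$ on $(T,2T]$. The Neumann problem on $J$ is $u''+\tilde a(t)u=\tilde\sigma(t)$ a.e. on $J$, $u'(0)=u'(2T)=0$; it is nonresonant if for $\tilde\sigma=0$ it has only the trivial solution, and then $G_N[\tilde a,2T]$ is its Green's function: the continuous function on $J\times J$ such that for each $\tilde\sigma\in L^1(J)$ the unique solution is $u(t)=\int_0^{2T}G_N[\tilde a,2T](t,s)\tilde\sigma(s)\,ds$. (If this problem is nonresonant, the two problems on $I$ with potential $a$ considered in the claim are uniquely solvable too.) *)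

theory Defs
  imports "HOL-Analysis.Analysis"
begin

text \<open>Absolute continuity on \<open>[l, r]\<close>: the usual epsilon-delta condition over finite families of
  non-overlapping subintervals \<open>[c i, d i]\<close>, \<open>i < n\<close>.\<close>

definition abs_cont_on :: "real \<Rightarrow> real \<Rightarrow> (real \<Rightarrow> real) \<Rightarrow> bool" where
  "abs_cont_on l r f \<longleftrightarrow>
    (\<forall>\<epsilon>>0. \<exists>\<delta>>0. \<forall>(n::nat) c d.
      (\<forall>i<n. l \<le> c i \<and> c i \<le> d i \<and> d i \<le> r) \<longrightarrow>
      (\<forall>i<n. \<forall>j<n. i \<noteq> j \<longrightarrow> {c i<..<d i} \<inter> {c j<..<d j} = {}) \<longrightarrow>
      (\<Sum>i<n. d i - c i) < \<delta> \<longrightarrow>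
      (\<Sum>i<n. \<bar>f (d i) - f (c i)\<bar>) < \<epsilon>)"

text \<open>\<open>u\<close> is a \<open>C\<^sup>1\<close> function on \<open>[0, L]\<close> with derivative \<open>v\<close> (one-sided at the endpoints), \<open>v\<close> is
  absolutely continuous, and \<open>u'' + a u = \<sigma>\<close> almost everywhere on \<open>[0, L]\<close>. Continuity of \<open>v\<close> is
  part of its absolute continuity. Only the values of \<open>u\<close> on \<open>[0, L]\<close> matter.\<close>

definition solves_hill ::
    "real \<Rightarrow> (real \<Rightarrow> real) \<Rightarrow> (real \<Rightarrow> real) \<Rightarrow> (real \<Rightarrow> real) \<Rightarrow> (real \<Rightarrow> real) \<Rightarrow> bool" where
  "solves_hill L a \<sigma> u v \<longleftrightarrow>
    (\<forall>t\<in>{0..L}. (u has_real_derivative v t) (at t within {0..L})) \<and>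
    abs_cont_on 0 L v \<and>
    (AE t in lebesgue. t \<in> {0..L} \<longrightarrow>
      (\<exists>w. (v has_real_derivative w) (at t within {0..L}) \<and> w + a t * u t = \<sigma> t))"

definition neumann_solution ::
    "real \<Rightarrow> (real \<Rightarrow> real) \<Rightarrow> (real \<Rightarrow> real) \<Rightarrow> (real \<Rightarrow> real) \<Rightarrow> bool" where
  "neumann_solution L a \<sigma> u \<longleftrightarrow> (\<exists>v. solves_hill L a \<sigma> u v \<and> v 0 = 0 \<and> v L = 0)"

definition mixed1_solution ::
    "real \<Rightarrow> (real \<Rightarrow> real) \<Rightarrow> (real \<Rightarrow> real) \<Rightarrow> (real \<Rightarrow> real) \<Rightarrow> bool" where
  "mixed1_solution L a \<sigma> u \<longleftrightarrow> (\<exists>v. solves_hill L a \<sigma> u v \<and> v 0 = 0 \<and> u L = 0)"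

definition neumann_nonresonant :: "real \<Rightarrow> (real \<Rightarrow> real) \<Rightarrow> bool" where
  "neumann_nonresonant L a \<longleftrightarrow>
    (\<forall>u. neumann_solution L a (\<lambda>_. 0) u \<longrightarrow> (\<forall>t\<in>{0..L}. u t = 0))"

text \<open>\<open>G\<close> is the Green's function (determined on the square \<open>[0, L] \<times> [0, L]\<close>): it is continuous
  there and for each integrable \<open>\<sigma>\<close> the integral formula gives, on \<open>[0, L]\<close>, the one and only
  solution.\<close>

definition is_neumann_green ::
    "real \<Rightarrow> (real \<Rightarrow> real) \<Rightarrow> (real \<Rightarrow> real \<Rightarrow> real) \<Rightarrow> bool" where
  "is_neumann_green L a G \<longleftrightarrow>
    continuous_on ({0..L} \<times> {0..L}) (\<lambda>(t, s). G t s) \<and>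
    (\<forall>\<sigma>. \<sigma> absolutely_integrable_on {0..L} \<longrightarrow>
      (\<forall>u. neumann_solution L a \<sigma> u \<longleftrightarrow>
        (\<forall>t\<in>{0..L}. u t = (LINT s:{0..L}|lebesgue. G t s * \<sigma> s))))"

definition even_extension :: "real \<Rightarrow> (real \<Rightarrow> real) \<Rightarrow> real \<Rightarrow> real" where
  "even_extension T a t = (if t \<le> T then a t else a (2 * T - t))"

end

theory Submission
  imports Defs
begin

text \<open>The two boundary value problems on \<open>[0, T]\<close> are both shadows of the single Neumann problem on
  \<open>[0, 2 T]\<close>. A Neumann solution \<open>u\<^sub>N\<close> satisfies \<open>u\<^sub>N' T = 0\<close>, so its even extension about \<open>T\<close> is still
  \<open>C\<^sup>1\<close>; a mixed solution \<open>u\<^sub>M\<close> satisfies \<open>u\<^sub>M T = 0\<close>, so its odd extension about \<open>T\<close> is. Since the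
  extended potential is symmetric about \<open>T\<close>, both extensions solve the Neumann problem on \<open>[0, 2 T]\<close>,
  with right-hand sides the even extension of \<open>\<sigma>\<^sub>1\<close> and the odd extension of \<open>\<sigma>\<^sub>2\<close>
  (\<open>neumann_solution_reflection_extension\<close>). Both are therefore represented by the same kernel \<open>G\<close>,
  and as \<open>G \<ge> 0\<close>, the bound \<open>\<bar>\<sigma>\<^sub>2\<bar> \<le> \<sigma>\<^sub>1\<close>, which the extensions inherit, passes through the integral
  (\<open>nonneg_green_comparison\<close>).

  The even and the odd case are treated together as extensions with a sign \<open>k = 1\<close> or \<open>k = -1\<close>.
  The sign of the extension of the derivative is then \<open>-k\<close>.\<close>

definition reflection_extension :: "real \<Rightarrow> real \<Rightarrow> (real \<Rightarrow> real) \<Rightarrow> real \<Rightarrow> real" where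
  "reflection_extension k T f t = (if t \<le> T then f t else k * f (2 * T - t))"

section \<open>Absolute continuity\<close>

definition nonoverlapping ::
    "real \<Rightarrow> real \<Rightarrow> nat \<Rightarrow> (nat \<Rightarrow> real) \<Rightarrow> (nat \<Rightarrow> real) \<Rightarrow> bool" where
  "nonoverlapping l r n c d \<longleftrightarrow>
    (\<forall>i<n. l \<le> c i \<and> c i \<le> d i \<and> d i \<le> r) \<and>
    (\<forall>i<n. \<forall>j<n. i \<noteq> j \<longrightarrow> {c i<..<d i} \<inter> {c j<..<d j} = {})"

lemma nonoverlappingI:
  assumes "\<And>i. i < n \<Longrightarrow> l \<le> c i \<and> c i \<le> d i \<and> d i \<le> r"
    and "\<And>i j x. \<lbrakk>i < n; j < n; i \<noteq> j; c i < x; x < d i; c j < x; x < d j\<rbrakk> \<Longrightarrow> False"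
  shows "nonoverlapping l r n c d"
  unfolding nonoverlapping_def
proof (intro conjI allI impI equals0I)
  fix i j x
  assume "i < n" "j < n" "i \<noteq> j" "x \<in> {c i<..<d i} \<inter> {c j<..<d j}"
  then show False using assms(2)[of i j x] by simp
qed (use assms(1) in blast)+

lemma nonoverlapping_bounds:
  "nonoverlapping l r n c d \<Longrightarrow> i < n \<Longrightarrow> l \<le> c i \<and> c i \<le> d i \<and> d i \<le> r"
  by (simp add: nonoverlapping_def)

lemma nonoverlapping_disjoint:
  assumes "nonoverlapping l r n c d" "i < n" "j < n" "i \<noteq> j"
    and "c i < x" "x < d i" "c j < x" "x < d j"
  shows False
proof -
  have "{c i<..<d i} \<inter> {c j<..<d j} = {}"
    using assms(1-4) unfolding nonoverlapping_def by blast
  moreover have "x \<in> {c i<..<d i} \<inter> {c j<..<d j}"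
    using assms(5-8) by simp
  ultimately show False by blast
qed

lemma abs_cont_on_iff:
  "abs_cont_on l r f \<longleftrightarrow> (\<forall>\<epsilon>>0. \<exists>\<delta>>0. \<forall>n c d. nonoverlapping l r n c d \<longrightarrow>
    (\<Sum>i<n. d i - c i) < \<delta> \<longrightarrow> (\<Sum>i<n. \<bar>f (d i) - f (c i)\<bar>) < \<epsilon>)"
  by (simp only: abs_cont_on_def nonoverlapping_def imp_conjL)

lemma abs_cont_onD:
  assumes "abs_cont_on l r f" and "\<epsilon> > 0"
  shows "\<exists>\<delta>>0. \<forall>n c d. nonoverlapping l r n c d \<longrightarrow>
    (\<Sum>i<n. d i - c i) < \<delta> \<longrightarrow> (\<Sum>i<n. \<bar>f (d i) - f (c i)\<bar>) < \<epsilon>"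
  using assms(1)[unfolded abs_cont_on_iff, THEN spec, THEN mp, OF assms(2)] .

lemma abs_cont_on_cong:
  assumes "abs_cont_on l r f" and "\<And>t. t \<in> {l..r} \<Longrightarrow> g t = f t"
  shows "abs_cont_on l r g"
  unfolding abs_cont_on_iff
proof (intro allI impI)
  fix \<epsilon> :: real
  assume "\<epsilon> > 0"
  obtain \<delta> where \<delta>: "\<delta> > 0"
    and D: "\<forall>n c d. nonoverlapping l r n c d \<longrightarrow>
      (\<Sum>i<n. d i - c i) < \<delta> \<longrightarrow> (\<Sum>i<n. \<bar>f (d i) - f (c i)\<bar>) < \<epsilon>"
    using abs_cont_onD[OF assms(1) \<open>\<epsilon> > 0\<close>] by (elim exE conjE)
  show "\<exists>\<delta>>0. \<forall>n c d. nonoverlapping l r n c d \<longrightarrow>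
      (\<Sum>i<n. d i - c i) < \<delta> \<longrightarrow> (\<Sum>i<n. \<bar>g (d i) - g (c i)\<bar>) < \<epsilon>"
  proof (intro exI conjI allI impI)
    fix n c d
    assume A: "nonoverlapping l r n c d" "(\<Sum>i<n. d i - c i) < \<delta>"
    have "g (d i) = f (d i)" "g (c i) = f (c i)" if "i < n" for i
      using nonoverlapping_bounds[OF A(1) that] assms(2)[of "d i"] assms(2)[of "c i"] by auto
    then have "(\<Sum>i<n. \<bar>g (d i) - g (c i)\<bar>) = (\<Sum>i<n. \<bar>f (d i) - f (c i)\<bar>)"
      by (intro sum.cong) auto
    then show "(\<Sum>i<n. \<bar>g (d i) - g (c i)\<bar>) < \<epsilon>"
      using D[rule_format, OF A] by simp
  qed (fact \<delta>)
qed

lemma abs_cont_on_reflect: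
  assumes f: "abs_cont_on l r f" and k: "\<bar>k\<bar> = 1"
  shows "abs_cont_on (p - r) (p - l) (\<lambda>t. k * f (p - t))"
  unfolding abs_cont_on_iff
proof (intro allI impI)
  fix \<epsilon> :: real
  assume "\<epsilon> > 0"
  obtain \<delta> where \<delta>: "\<delta> > 0"
    and D: "\<forall>n c d. nonoverlapping l r n c d \<longrightarrow>
      (\<Sum>i<n. d i - c i) < \<delta> \<longrightarrow> (\<Sum>i<n. \<bar>f (d i) - f (c i)\<bar>) < \<epsilon>"
    using abs_cont_onD[OF f \<open>\<epsilon> > 0\<close>] by (elim exE conjE)
  show "\<exists>\<delta>>0. \<forall>n c d. nonoverlapping (p - r) (p - l) n c d \<longrightarrow>
      (\<Sum>i<n. d i - c i) < \<delta> \<longrightarrow> (\<Sum>i<n. \<bar>k * f (p - d i) - k * f (p - c i)\<bar>) < \<epsilon>"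
  proof (intro exI conjI allI impI)
    fix n c d
    assume A: "nonoverlapping (p - r) (p - l) n c d" "(\<Sum>i<n. d i - c i) < \<delta>"
    have "\<bar>k * f (p - d i) - k * f (p - c i)\<bar> = \<bar>f (p - c i) - f (p - d i)\<bar>" for i
      using k unfolding right_diff_distrib[symmetric] abs_mult by simp
    moreover have "(\<Sum>i<n. \<bar>f (p - c i) - f (p - d i)\<bar>) < \<epsilon>"
    proof (rule D[rule_format])
      show "nonoverlapping l r n (\<lambda>i. p - d i) (\<lambda>i. p - c i)"
      proof (rule nonoverlappingI)
        show "l \<le> p - d i \<and> p - d i \<le> p - c i \<and> p - c i \<le> r" if "i < n" for i
          using nonoverlapping_bounds[OF A(1) that] by linarith
        show False if "i < n" "j < n" "i \<noteq> j" "p - d i < x" "x < p - c i" "p - d j < x" "x < p - c j"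
          for i j x
          using nonoverlapping_disjoint[OF A(1) that(1-3), of "p - x"] that(4-7) by linarith
      qed
      show "(\<Sum>i<n. (p - c i) - (p - d i)) < \<delta>"
        using A(2) by simp
    qed
    ultimately show "(\<Sum>i<n. \<bar>k * f (p - d i) - k * f (p - c i)\<bar>) < \<epsilon>"
      by simp
  qed (fact \<delta>)
qed

text \<open>Cutting each interval of a family at \<open>m\<close> gives a family on either side of \<open>m\<close>; pieces on the
  wrong side degenerate to the point \<open>m\<close> and contribute nothing. Cutting does not increase the total
  length on either side, and the triangle inequality at \<open>m\<close> bounds the variation.\<close>

lemma abs_cont_on_combine:
  assumes f1: "abs_cont_on l m f" and f2: "abs_cont_on m r f" and "l \<le> m" "m \<le> r"
  shows "abs_cont_on l r f"
  unfolding abs_cont_on_iff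
proof (intro allI impI)
  fix \<epsilon> :: real
  assume "\<epsilon> > 0"
  then have e2: "\<epsilon> / 2 > 0" by simp
  obtain \<delta>1 where \<delta>1: "\<delta>1 > 0"
    and D1: "\<forall>n c d. nonoverlapping l m n c d \<longrightarrow>
      (\<Sum>i<n. d i - c i) < \<delta>1 \<longrightarrow> (\<Sum>i<n. \<bar>f (d i) - f (c i)\<bar>) < \<epsilon> / 2"
    using abs_cont_onD[OF f1 e2] by (elim exE conjE)
  obtain \<delta>2 where \<delta>2: "\<delta>2 > 0"
    and D2: "\<forall>n c d. nonoverlapping m r n c d \<longrightarrow>
      (\<Sum>i<n. d i - c i) < \<delta>2 \<longrightarrow> (\<Sum>i<n. \<bar>f (d i) - f (c i)\<bar>) < \<epsilon> / 2"
    using abs_cont_onD[OF f2 e2] by (elim exE conjE)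
  show "\<exists>\<delta>>0. \<forall>n c d. nonoverlapping l r n c d \<longrightarrow>
      (\<Sum>i<n. d i - c i) < \<delta> \<longrightarrow> (\<Sum>i<n. \<bar>f (d i) - f (c i)\<bar>) < \<epsilon>"
  proof (intro exI conjI allI impI)
    show "min \<delta>1 \<delta>2 > 0" using \<delta>1 \<delta>2 by simp
    fix n c d
    assume A: "nonoverlapping l r n c d" "(\<Sum>i<n. d i - c i) < min \<delta>1 \<delta>2"
    note bounds = nonoverlapping_bounds[OF A(1)]
    have "(\<Sum>i<n. \<bar>f (min (d i) m) - f (min (c i) m)\<bar>) < \<epsilon> / 2"
    proof (rule D1[rule_format])
      show "nonoverlapping l m n (\<lambda>i. min (c i) m) (\<lambda>i. min (d i) m)"
      proof (rule nonoverlappingI)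
        show "l \<le> min (c i) m \<and> min (c i) m \<le> min (d i) m \<and> min (d i) m \<le> m" if "i < n" for i
          using bounds[OF that] \<open>l \<le> m\<close> by linarith
        show False if "i < n" "j < n" "i \<noteq> j" "min (c i) m < x" "x < min (d i) m"
          "min (c j) m < x" "x < min (d j) m" for i j x
          using nonoverlapping_disjoint[OF A(1) that(1-3), of x] that(4-7) by linarith
      qed
      have "(\<Sum>i<n. min (d i) m - min (c i) m) \<le> (\<Sum>i<n. d i - c i)"
        using bounds by (intro sum_mono) (force simp: min_def)
      then show "(\<Sum>i<n. min (d i) m - min (c i) m) < \<delta>1"
        using A(2) by linarith
    qed
    moreover have "(\<Sum>i<n. \<bar>f (max (d i) m) - f (max (c i) m)\<bar>) < \<epsilon> / 2"
    proof (rule D2[rule_format])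
      show "nonoverlapping m r n (\<lambda>i. max (c i) m) (\<lambda>i. max (d i) m)"
      proof (rule nonoverlappingI)
        show "m \<le> max (c i) m \<and> max (c i) m \<le> max (d i) m \<and> max (d i) m \<le> r" if "i < n" for i
          using bounds[OF that] \<open>m \<le> r\<close> by linarith
        show False if "i < n" "j < n" "i \<noteq> j" "max (c i) m < x" "x < max (d i) m"
          "max (c j) m < x" "x < max (d j) m" for i j x
          using nonoverlapping_disjoint[OF A(1) that(1-3), of x] that(4-7) by linarith
      qed
      have "(\<Sum>i<n. max (d i) m - max (c i) m) \<le> (\<Sum>i<n. d i - c i)"
        using bounds by (intro sum_mono) (force simp: max_def)
      then show "(\<Sum>i<n. max (d i) m - max (c i) m) < \<delta>2"
        using A(2) by linarith
    qed
    moreover have "(\<Sum>i<n. \<bar>f (d i) - f (c i)\<bar>) \<le>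
      (\<Sum>i<n. \<bar>f (min (d i) m) - f (min (c i) m)\<bar>) + (\<Sum>i<n. \<bar>f (max (d i) m) - f (max (c i) m)\<bar>)"
      unfolding sum.distrib[symmetric] by (intro sum_mono) (auto simp: min_def max_def)
    ultimately show "(\<Sum>i<n. \<bar>f (d i) - f (c i)\<bar>) < \<epsilon>"
      by linarith
  qed
qed

section \<open>Extension by reflection\<close>

lemma reflection_extension_left: "t \<le> T \<Longrightarrow> reflection_extension k T f t = f t"
  by (simp add: reflection_extension_def)

text \<open>The hypothesis on \<open>f T\<close> says that the two branches agree at \<open>T\<close>: it is vacuous for an even
  extension and says \<open>f T = 0\<close> for an odd one.\<close>

lemma reflection_extension_right:
  assumes "T \<le> t" and "k * f T = f T"
  shows "reflection_extension k T f t = k * f (2 * T - t)"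
  using assms by (cases "t = T") (auto simp: reflection_extension_def)

lemma abs_cont_on_reflection_extension:
  assumes f: "abs_cont_on 0 T f" and k: "\<bar>k\<bar> = 1" and "k * f T = f T" "T \<ge> 0"
  shows "abs_cont_on 0 (2 * T) (reflection_extension k T f)"
proof (rule abs_cont_on_combine)
  show "abs_cont_on 0 T (reflection_extension k T f)"
    by (rule abs_cont_on_cong[OF f]) (simp add: reflection_extension_left)
  have "abs_cont_on T (2 * T) (\<lambda>t. k * f (2 * T - t))"
    using abs_cont_on_reflect[OF f k, of "2 * T"] by simp
  then show "abs_cont_on T (2 * T) (reflection_extension k T f)"
    by (rule abs_cont_on_cong) (use assms in \<open>auto intro: reflection_extension_right\<close>)
qed (use \<open>T \<ge> 0\<close> in auto)

lemma has_field_derivative_within_closed_Un: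
  fixes f :: "real \<Rightarrow> real"
  assumes "closed A" "closed B"
    and "t \<in> A \<Longrightarrow> (f has_real_derivative D) (at t within A)"
    and "t \<in> B \<Longrightarrow> (f has_real_derivative D) (at t within B)"
  shows "(f has_real_derivative D) (at t within A \<union> B)"
proof -
  have *: "(f has_real_derivative D) (at t within S)"
    if "closed S" "t \<in> S \<Longrightarrow> (f has_real_derivative D) (at t within S)" for S
  proof (cases "t \<in> S")
    case False
    \<comment> \<open>Away from a closed set the punctured neighbourhood filter is trivial.\<close>
    then have "at t within S = bot"
      using that(1) by (metis closed_limpt trivial_limit_within)
    then show ?thesis by (simp add: has_field_derivative_iff)
  qed (use that in simp)
  show ?thesis
    using *[OF assms(1,3)] *[OF assms(2,4)]
    by (simp add: has_field_derivative_iff Lim_within_Un)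
qed

text \<open>The derivatives from the two sides are supplied separately, so that the lemma serves the first
  derivative, where both sides are needed at \<open>T\<close>, as well as the second derivative, which is known
  only almost everywhere and may fail to exist at \<open>T\<close>.\<close>

lemma has_real_derivative_reflection_extension:
  assumes "T \<ge> 0" and match: "k * f T = f T"
    and left: "t \<le> T \<Longrightarrow> (f has_real_derivative D) (at t within {0..T})"
    and right: "T \<le> t \<Longrightarrow> (f has_real_derivative E) (at (2 * T - t) within {0..T})"
      "T \<le> t \<Longrightarrow> D = - k * E"
  shows "(reflection_extension k T f has_real_derivative D) (at t within {0..2 * T})"
proof -
  have "(reflection_extension k T f has_real_derivative D) (at t within {0..T} \<union> {T..2 * T})"
  proof (rule has_field_derivative_within_closed_Un)
    assume t: "t \<in> {0..T}"
    then have "(f has_real_derivative D) (at t within {0..T})" using left by simp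
    then show "(reflection_extension k T f has_real_derivative D) (at t within {0..T})"
      by (rule has_field_derivative_transform_within[of _ _ _ _ 1])
        (use t in \<open>auto simp: reflection_extension_left\<close>)
  next
    assume t: "t \<in> {T..2 * T}"
    have img: "(\<lambda>x. 2 * T - x) ` {T..2 * T} = {0..T}"
      by (auto simp: image_iff intro!: bexI[of _ "2 * T - _"])
    have "((\<lambda>x. 2 * T - x) has_real_derivative -1) (at t within {T..2 * T})"
      by (auto intro!: derivative_eq_intros)
    then have "((f \<circ> (\<lambda>x. 2 * T - x)) has_real_derivative E * -1) (at t within {T..2 * T})"
      using right(1) t by (intro DERIV_image_chain) (auto simp: img)
    then have "((\<lambda>x. k * (f \<circ> (\<lambda>x. 2 * T - x)) x) has_real_derivative k * (E * -1))
        (at t within {T..2 * T})"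
      by (rule DERIV_cmult)
    then have "((\<lambda>x. k * f (2 * T - x)) has_real_derivative D) (at t within {T..2 * T})"
      using right(2) t by simp
    then show "(reflection_extension k T f has_real_derivative D) (at t within {T..2 * T})"
      by (rule has_field_derivative_transform_within[of _ _ _ _ 1])
        (use t match in \<open>auto simp: reflection_extension_right\<close>)
  qed auto
  moreover have "{0..T} \<union> {T..2 * T} = {0..2 * T}" using \<open>T \<ge> 0\<close> by auto
  ultimately show ?thesis by simp
qed

lemma AE_lebesgue_reflect:
  fixes P :: "real \<Rightarrow> bool"
  assumes "AE t in lebesgue. P t"
  shows "AE t in lebesgue. P (p - t)"
proof -
  obtain N where N: "negligible N" "{t. \<not> P t} \<subseteq> N"
    using assms by (auto simp: eventually_ae_filter_negligible)
  have "negligible ((\<lambda>t. p - t) ` N)"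
    using N(1) by (rule negligible_differentiable_image_negligible[rotated])
      (auto intro!: derivative_intros)
  moreover have "{t. \<not> P (p - t)} \<subseteq> (\<lambda>t. p - t) ` N"
    using N(2) by (auto simp: image_iff intro!: bexI[of _ "p - _"])
  ultimately show ?thesis
    by (auto simp: eventually_ae_filter_negligible)
qed

lemma absolutely_integrable_reflection_extension:
  assumes f: "f absolutely_integrable_on {0..T}" and "T \<ge> 0"
  shows "reflection_extension k T f absolutely_integrable_on {0..2 * T}"
proof -
  have "reflection_extension k T f absolutely_integrable_on {0..T}"
    using f by (rule absolutely_integrable_spike[of _ _ "{}"]) (auto simp: reflection_extension_left)
  moreover have "reflection_extension k T f absolutely_integrable_on {T..2 * T}"
  proof (rule absolutely_integrable_spike[of _ _ "{T}"])
    have "integrable lebesgue (\<lambda>x. indicator {0..T} (2 * T + (-1) * x) *\<^sub>R f (2 * T + (-1) * x))"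
      using f unfolding set_integrable_def by (intro lebesgue_integrable_real_affine) auto
    moreover have "indicator {0..T} (2 * T - x) = (indicator {T..2 * T} x :: real)" for x
      by (auto simp: indicator_def)
    ultimately have "(\<lambda>x. f (2 * T - x)) absolutely_integrable_on {T..2 * T}"
      by (simp add: set_integrable_def)
    then show "(\<lambda>x. k * f (2 * T - x)) absolutely_integrable_on {T..2 * T}"
      by simp
  qed (auto simp: reflection_extension_def)
  ultimately have "reflection_extension k T f absolutely_integrable_on ({0..T} \<union> {T..2 * T})"
    by (rule absolutely_integrable_Un)
  moreover have "{0..T} \<union> {T..2 * T} = {0..2 * T}" using \<open>T \<ge> 0\<close> by auto
  ultimately show ?thesis by simp
qed

section \<open>From the half interval to the whole interval\<close>

text \<open>On the right half, \<open>k u(2 T - t)\<close> has second derivative \<open>k u''(2 T - t)\<close> and meets the potential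
  \<open>a(2 T - t)\<close>, so it satisfies the reflected equation multiplied by \<open>k\<close>. For \<open>k = 1\<close> the matching conditions read
  \<open>v T = 0\<close> (Neumann), for \<open>k = -1\<close> they read \<open>u T = 0\<close> (mixed).\<close>

lemma neumann_solution_reflection_extension:
  assumes T: "T > 0" and sol: "solves_hill T a \<sigma> u v" and "v 0 = 0"
    and k: "\<bar>k\<bar> = 1" and matchu: "k * u T = u T" and matchv: "- k * v T = v T"
  shows "neumann_solution (2 * T) (even_extension T a)
    (reflection_extension k T \<sigma>) (reflection_extension k T u)"
proof -
  let ?u = "reflection_extension k T u" and ?v = "reflection_extension (- k) T v"
  let ?eq = "\<lambda>t. t \<in> {0..T} \<longrightarrow>
      (\<exists>w. (v has_real_derivative w) (at t within {0..T}) \<and> w + a t * u t = \<sigma> t)"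
  have du: "(u has_real_derivative v t) (at t within {0..T})" if "t \<in> {0..T}" for t
    using sol that by (simp add: solves_hill_def)
  have "(?u has_real_derivative ?v t) (at t within {0..2 * T})" if "t \<in> {0..2 * T}" for t
  proof (rule has_real_derivative_reflection_extension[where E = "v (2 * T - t)"])
    show "(u has_real_derivative ?v t) (at t within {0..T})" if "t \<le> T"
      using du[of t] that \<open>t \<in> {0..2 * T}\<close> by (simp add: reflection_extension_left)
    show "(u has_real_derivative v (2 * T - t)) (at (2 * T - t) within {0..T})" if "T \<le> t"
      using du[of "2 * T - t"] that \<open>t \<in> {0..2 * T}\<close> by simp
    show "?v t = - k * v (2 * T - t)" if "T \<le> t"
      using that matchv by (rule reflection_extension_right)
  qed (use T matchu in auto)
  moreover have "abs_cont_on 0 (2 * T) ?v"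
    using sol k matchv T by (intro abs_cont_on_reflection_extension) (auto simp: solves_hill_def)
  moreover have "AE t in lebesgue. t \<in> {0..2 * T} \<longrightarrow>
      (\<exists>w. (?v has_real_derivative w) (at t within {0..2 * T}) \<and>
        w + even_extension T a t * ?u t = reflection_extension k T \<sigma> t)"
  proof -
    have eq: "AE t in lebesgue. ?eq t"
      using sol by (simp add: solves_hill_def)
    have "AE t in lebesgue. t \<noteq> T"
      by (rule AE_I'[of "{T}"]) (auto simp flip: negligible_iff_null_sets)
    with eq AE_lebesgue_reflect[OF eq, of "2 * T"] show ?thesis
    proof eventually_elim
      case (elim t)
      show ?case
      proof
        assume t: "t \<in> {0..2 * T}"
        show "\<exists>w. (?v has_real_derivative w) (at t within {0..2 * T}) \<and>
          w + even_extension T a t * ?u t = reflection_extension k T \<sigma> t"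
        proof (cases "t < T")
          case True
          then obtain w where w: "(v has_real_derivative w) (at t within {0..T})"
              "w + a t * u t = \<sigma> t"
            using elim(1) t by auto
          have "(?v has_real_derivative w) (at t within {0..2 * T})"
            using T matchv w(1) True
            by (intro has_real_derivative_reflection_extension) auto
          then show ?thesis
            using w(2) True by (auto simp: reflection_extension_def even_extension_def)
        next
          case False
          with elim(3) have "t > T" by simp
          then obtain w where w: "(v has_real_derivative w) (at (2 * T - t) within {0..T})"
              "w + a (2 * T - t) * u (2 * T - t) = \<sigma> (2 * T - t)"
            using elim(2) t by auto
          \<comment> \<open>Reflecting a second time restores the sign: \<open>k * w = - (- k) * w\<close>.\<close>
          have "(?v has_real_derivative k * w) (at t within {0..2 * T})"
            using T matchv w(1) \<open>t > T\<close>
            by (intro has_real_derivative_reflection_extension[where E = w]) auto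
          moreover have "k * w + a (2 * T - t) * (k * u (2 * T - t)) = k * \<sigma> (2 * T - t)"
            unfolding w(2)[symmetric] by (simp add: algebra_simps)
          ultimately show ?thesis
            using \<open>t > T\<close> by (auto simp: reflection_extension_def even_extension_def)
        qed
      qed
    qed
  qed
  moreover have "?v 0 = 0" "?v (2 * T) = 0"
    using T \<open>v 0 = 0\<close> by (auto simp: reflection_extension_def)
  ultimately show ?thesis
    unfolding neumann_solution_def solves_hill_def by blast
qed

section \<open>Comparison through the Green's function\<close>

text \<open>A nonnegative kernel acts as a monotone operator. Its continuity makes \<open>G t\<close> bounded, hence
  \<open>G t\<close> times an integrable function integrable, so that the integrals can be compared.\<close>

lemma nonneg_green_comparison:
  assumes green: "is_neumann_green L a G"
    and nonneg: "\<forall>t\<in>{0..L}. \<forall>s\<in>{0..L}. G t s \<ge> 0"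
    and f: "f absolutely_integrable_on {0..L}" and g: "g absolutely_integrable_on {0..L}"
    and u: "neumann_solution L a f u" and w: "neumann_solution L a g w"
    and le: "AE s in lebesgue. s \<in> {0..L} \<longrightarrow> \<bar>g s\<bar> \<le> f s"
    and t: "t \<in> {0..L}"
  shows "\<bar>w t\<bar> \<le> u t"
proof -
  have "continuous_on {0..L} (\<lambda>s. (\<lambda>(t, s). G t s) (t, s))"
    using green t unfolding is_neumann_green_def
    by (intro continuous_on_compose2[of _ "\<lambda>(t, s). G t s" _ "\<lambda>s. (t, s)"])
      (auto intro!: continuous_intros)
  then have cont: "continuous_on {0..L} (G t)" by simp
  have int: "set_integrable lebesgue {0..L} (\<lambda>s. G t s * h s)"
    if "h absolutely_integrable_on {0..L}" for h
  proof (rule absolutely_integrable_bounded_measurable_product_real[OF _ _ _ that])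
    show "G t \<in> borel_measurable (lebesgue_on {0..L})"
      using cont by (intro continuous_imp_measurable_on_sets_lebesgue) auto
    show "bounded (G t ` {0..L})"
      using cont by (intro compact_imp_bounded compact_continuous_image) auto
  qed auto
  have "\<bar>w t\<bar> = \<bar>LINT s:{0..L}|lebesgue. G t s * g s\<bar>"
    using green g w t by (auto simp: is_neumann_green_def)
  also have "\<dots> \<le> (LINT s|lebesgue. \<bar>indicator {0..L} s *\<^sub>R (G t s * g s)\<bar>)"
    unfolding set_lebesgue_integral_def by (rule integral_abs_bound)
  also have "\<dots> \<le> (LINT s:{0..L}|lebesgue. G t s * f s)"
    unfolding set_lebesgue_integral_def
  proof (rule integral_mono_AE)
    show "AE s in lebesgue. \<bar>indicator {0..L} s *\<^sub>R (G t s * g s)\<bar>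
        \<le> indicator {0..L} s *\<^sub>R (G t s * f s)"
      using le
    proof eventually_elim
      case (elim s)
      then show ?case
        using nonneg t by (auto simp: indicator_def abs_mult intro!: mult_left_mono)
    qed
  qed (use int[OF f] int[OF g] in \<open>auto simp: set_integrable_def\<close>)
  also have "\<dots> = u t"
    using green f u t by (auto simp: is_neumann_green_def)
  finally show ?thesis .
qed

theorem theorem4p14:
  fixes T :: real
    and a \<sigma>\<^sub>1 \<sigma>\<^sub>2 u\<^sub>N u\<^sub>M :: "real \<Rightarrow> real"
    and G :: "real \<Rightarrow> real \<Rightarrow> real"
  assumes "T > 0"
    and "a absolutely_integrable_on {0..T}"
    and "neumann_nonresonant (2 * T) (even_extension T a)"
    and "is_neumann_green (2 * T) (even_extension T a) G"
    and "\<forall>t\<in>{0..2 * T}. \<forall>s\<in>{0..2 * T}. G t s \<ge> 0"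
    and "\<sigma>\<^sub>1 absolutely_integrable_on {0..T}"
    and "\<sigma>\<^sub>2 absolutely_integrable_on {0..T}"
    and "neumann_solution T a \<sigma>\<^sub>1 u\<^sub>N"
    and "mixed1_solution T a \<sigma>\<^sub>2 u\<^sub>M"
    and "AE t in lebesgue. t \<in> {0..T} \<longrightarrow> \<bar>\<sigma>\<^sub>2 t\<bar> \<le> \<sigma>\<^sub>1 t"
  shows "\<forall>t\<in>{0..T}. \<bar>u\<^sub>M t\<bar> \<le> u\<^sub>N t"
proof
  fix t
  assume t: "t \<in> {0..T}"
  obtain v\<^sub>N where v\<^sub>N: "solves_hill T a \<sigma>\<^sub>1 u\<^sub>N v\<^sub>N" "v\<^sub>N 0 = 0" "v\<^sub>N T = 0"
    using assms(8) by (auto simp: neumann_solution_def)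
  obtain v\<^sub>M where v\<^sub>M: "solves_hill T a \<sigma>\<^sub>2 u\<^sub>M v\<^sub>M" "v\<^sub>M 0 = 0" "u\<^sub>M T = 0"
    using assms(9) by (auto simp: mixed1_solution_def)
  have "AE s in lebesgue. s \<in> {0..2 * T} \<longrightarrow>
      \<bar>reflection_extension (-1) T \<sigma>\<^sub>2 s\<bar> \<le> reflection_extension 1 T \<sigma>\<^sub>1 s"
    using assms(10) AE_lebesgue_reflect[OF assms(10), of "2 * T"]
    by eventually_elim (auto simp: reflection_extension_def)
  moreover have "neumann_solution (2 * T) (even_extension T a)
      (reflection_extension 1 T \<sigma>\<^sub>1) (reflection_extension 1 T u\<^sub>N)"
    using assms(1) v\<^sub>N
    by (intro neumann_solution_reflection_extension[where v = v\<^sub>N]) auto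
  moreover have "neumann_solution (2 * T) (even_extension T a)
      (reflection_extension (-1) T \<sigma>\<^sub>2) (reflection_extension (-1) T u\<^sub>M)"
    using assms(1) v\<^sub>M
    by (intro neumann_solution_reflection_extension[where v = v\<^sub>M]) auto
  moreover have "reflection_extension 1 T \<sigma>\<^sub>1 absolutely_integrable_on {0..2 * T}"
      "reflection_extension (-1) T \<sigma>\<^sub>2 absolutely_integrable_on {0..2 * T}"
    using assms(1,6,7) by (auto intro: absolutely_integrable_reflection_extension)
  moreover have "t \<in> {0..2 * T}"
    using t by auto
  ultimately have "\<bar>reflection_extension (-1) T u\<^sub>M t\<bar> \<le> reflection_extension 1 T u\<^sub>N t"
    by (intro nonneg_green_comparison[OF assms(4,5)])
  then show "\<bar>u\<^sub>M t\<bar> \<le> u\<^sub>N t"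
    using t by (simp add: reflection_extension_left)
qed

end
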